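(* Let $k,d$ be positive integers and let $\Gamma$ be a finite, simple, strongly connected digraph with $\dim(\Gamma)=k$ and diameter $d$. Then $$k+d\leq |A(\Gamma)|\leq \Big(\frac{d^2+3d-2}{2}\Big)^{2k}+(2k-d)d^{2k-1}+k^2-k.$$ Moreover: (i) the lower bound is attained if and only if $k=1$ and $\Gamma$ is isomorphic to a directed cycle of length $d+1$; (ii) the upper bound is attained if and only if one of the following holds: (a) $k=1$ and $\Gamma$ is isomorphic to $\Gamma(d^2+1,d)$; (b) $d=1$ and $\Gamma$ is isomorphic to the complete digraph of order $k+1$; (c) $d=2$ and $\Gamma$ is isomorphic to $\overline{\Gamma}(4^k+k,2)$.
   Context: All digraphs are finite, simple (no loops, at most one arc per ordered pair) and strongly connected; $A(\Gamma)$ is the arc set. $\partial(x,y)$ is the length of a shortest directed path from $x$ to $y$, $\tilde\partial(x,y)=(\partial(x,y),\partial(y,x))$, and the diameter is $\max_{x,y}\partial(x,y)$. A set $\{w_1,\dots,w_m\}\subseteq V(\Gamma)$ is weakly resolving if $(\tilde\partial(w_1,u),\dots,\tilde\partial(w_m,u))\neq(\tilde\partial(w_1,v),\dots,\tilde\partial(w_m,v))$ for all distinct $u,v$; $\dim(\Gamma)$ is the minimum size of a weakly resolving set. The complete digraph has every ordered pair of distinct vertices as an arc. For positive integers $k,d$, the digraph $\Gamma(d^{2k}+k,d)$ has vertex set $\{u_1,\dots,u_k\}\cup\{1,\dots,d\}^{2k}$ (the $u_i$ are $k$ extra vertices, the others are $2k$-tuples), and its arcs are exactly: (F1) $(u_i,(a_1,\dots,a_{2k}))$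 whenever $a_{2i-1}=1$; (F2) $((a_1,\dots,a_{2k}),u_i)$ whenever $a_{2i}=1$; (F3) $((a_1,\dots,a_{2k}),(b_1,\dots,b_{2k}))$ whenever the tuples are distinct and $a_{2r-1}-b_{2r-1}\geq -1$ and $a_{2r}-b_{2r}\leq 1$ for every $r=1,\dots,k$. (There are no arcs between distinct $u_i,u_j$.) The digraph $\overline{\Gamma}(d^{2k}+k,d)$ is obtained from $\Gamma(d^{2k}+k,d)$ by adding both arcs $(u_i,u_j)$ and $(u_j,u_i)$ for all $1\leq i<j\leq k$. *)

theory Defs
  imports Complex_Main "HOL-Library.FuncSet" "Graph_Theory.Graph_Theory"
begin

context pre_digraph
begin

text \<open>Only meaningful if \<open>v\<close> is reachable from \<open>u\<close>.\<close>

definition ddist :: "'a \<Rightarrow> 'a \<Rightarrow> nat" where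
  "ddist u v = (LEAST n. \<exists>p. apath u p v \<and> length p = n)"

definition two_way_dist :: "'a \<Rightarrow> 'a \<Rightarrow> nat \<times> nat" where
  "two_way_dist u v = (ddist u v, ddist v u)"

definition diam :: nat where
  "diam = Max {ddist u v | u v. u \<in> verts G \<and> v \<in> verts G}"

definition weakly_resolving :: "'a set \<Rightarrow> bool" where
  "weakly_resolving W \<longleftrightarrow> finite W \<and> W \<subseteq> verts G \<and>
    (\<forall>u\<in>verts G. \<forall>v\<in>verts G. u \<noteq> v \<longrightarrow> (\<exists>w\<in>W. two_way_dist w u \<noteq> two_way_dist w v))"

definition weak_dim :: nat where
  "weak_dim = (LEAST m. \<exists>W. weakly_resolving W \<and> card W = m)"

end

definition directed_cycle :: "nat \<Rightarrow> nat pair_pre_digraph" where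
  "directed_cycle n = \<lparr> pverts = {..<n}, parcs = {(i, Suc i mod n) | i. i < n} \<rparr>"

definition standard_complete :: "nat \<Rightarrow> nat pair_pre_digraph" where
  "standard_complete n = \<lparr> pverts = {..<n}, parcs = {(i, j). i < n \<and> j < n \<and> i \<noteq> j} \<rparr>"

lemma complete_digraph_standard_complete:
  "complete_digraph n (with_proj (standard_complete n))"
  unfolding complete_digraph_pair_def by (auto simp: standard_complete_def)

datatype gamma_vertex = U nat | Tup "nat \<Rightarrow> nat"

text \<open>A tuple \<open>(a\<^sub>1, \<dots>, a\<^sub>2\<^sub>k)\<close> is a function that is \<open>undefined\<close> outside \<open>{1..2 * k}\<close>.\<close>

definition tuples :: "nat \<Rightarrow> nat \<Rightarrow> (nat \<Rightarrow> nat) set" where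
  "tuples k d = {1..2 * k} \<rightarrow>\<^sub>E {1..d}"

text \<open>\<open>Gamma_digraph k d\<close> is $\Gamma(d^{2k}+k,d)$ and \<open>Gamma_bar_digraph k d\<close> is
  $\overline{\Gamma}(d^{2k}+k,d)$.\<close>

definition Gamma_digraph :: "nat \<Rightarrow> nat \<Rightarrow> gamma_vertex pair_pre_digraph" where
  "Gamma_digraph k d = \<lparr>
    pverts = U ` {1..k} \<union> Tup ` tuples k d,
    parcs =
      {(U i, Tup a) | i a. i \<in> {1..k} \<and> a \<in> tuples k d \<and> a (2 * i - 1) = 1}
      \<union> {(Tup a, U i) | i a. i \<in> {1..k} \<and> a \<in> tuples k d \<and> a (2 * i) = 1}
      \<union> {(Tup a, Tup b) | a b. a \<in> tuples k d \<and> b \<in> tuples k d \<and> a \<noteq> b \<and>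
          (\<forall>r\<in>{1..k}. int (a (2 * r - 1)) - int (b (2 * r - 1)) \<ge> -1 \<and>
                      int (a (2 * r)) - int (b (2 * r)) \<le> 1)} \<rparr>"

definition Gamma_bar_digraph :: "nat \<Rightarrow> nat \<Rightarrow> gamma_vertex pair_pre_digraph" where
  "Gamma_bar_digraph k d = \<lparr>
    pverts = pverts (Gamma_digraph k d),
    parcs = parcs (Gamma_digraph k d) \<union>
      {(U i, U j) | i j. i \<in> {1..k} \<and> j \<in> {1..k} \<and> i \<noteq> j} \<rparr>"

end

theory Submission
  imports Defs
begin

text \<open>Upper bound: fix a minimum weakly resolving set \<open>w\<^sub>1, \<dots>, w\<^sub>k\<close>. Sending \<open>w\<^sub>i\<close> to \<open>u\<^sub>i\<close> and every other
  vertex \<open>x\<close> to the tuple of all distances \<open>\<partial>(w\<^sub>i, x)\<close>, \<open>\<partial>(x, w\<^sub>i)\<close> embeds the digraph into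
  $\overline{\Gamma}(d^{2k}+k,d)$, whose number of arcs is exactly the bound; so equality means that the
  embedding is an isomorphism. If \<open>k \<ge> 2\<close> and \<open>d \<ge> 3\<close> this is impossible, since the arcs
  \<open>w\<^sub>2 \<rightarrow> w\<^sub>1 \<rightarrow> x\<close> exclude a tuple with \<open>\<partial>(w\<^sub>1, x) = 1\<close> and \<open>\<partial>(w\<^sub>2, x) = 3\<close>.

  Lower bound: removing the last \<open>d\<close> vertices of a geodesic of length \<open>d\<close> leaves a weakly resolving set, so
  there are at least \<open>k + d\<close> vertices, each with an outgoing arc. In the case of equality every vertex has
  exactly one outgoing arc, and the distance from a fixed vertex numbers the vertices along a cycle.\<close>

subsection \<open>Embeddings into digraphs of pairs\<close>

context pre_digraph
begin

definition arc_embedding :: "('a \<Rightarrow> 'c) \<Rightarrow> 'c pair_pre_digraph \<Rightarrow> bool" where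
  "arc_embedding f H \<longleftrightarrow> inj_on f (verts G) \<and> f ` verts G \<subseteq> pverts H \<and>
    map_prod f f ` arcs_ends G \<subseteq> parcs H"

definition pair_isomorphism :: "('a \<Rightarrow> 'c) \<Rightarrow> 'c pair_pre_digraph \<Rightarrow> bool" where
  "pair_isomorphism f H \<longleftrightarrow> bij_betw f (verts G) (pverts H) \<and> map_prod f f ` arcs_ends G = parcs H"

lemma arc_embeddingI:
  assumes "inj_on f (verts G)"
    and "\<And>x. x \<in> verts G \<Longrightarrow> f x \<in> pverts H"
    and "\<And>x y. x \<rightarrow> y \<Longrightarrow> (f x, f y) \<in> parcs H"
  shows "arc_embedding f H"
  using assms by (auto simp: arc_embedding_def)

end

lemma digraph_iso_card_arcs:
  assumes "digraph_iso G H"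
  shows "card (arcs G) = card (arcs H)"
  using assms unfolding digraph_iso_def
  by (auto simp: card_image pre_digraph.digraph_isomorphism_inj_on_arcs)

lemma (in wf_digraph) pair_isomorphism_adj_iff:
  assumes "pair_isomorphism f H" "x \<in> verts G" "y \<in> verts G"
  shows "x \<rightarrow> y \<longleftrightarrow> (f x, f y) \<in> parcs H"
proof
  assume "(f x, f y) \<in> parcs H"
  then have "(f x, f y) \<in> map_prod f f ` arcs_ends G"
    using assms(1) by (simp add: pair_isomorphism_def)
  then obtain u v where uv: "u \<rightarrow> v" "f u = f x" "f v = f y" by auto
  moreover have "inj_on f (verts G)"
    using assms(1) by (simp add: pair_isomorphism_def bij_betw_def)
  ultimately show "x \<rightarrow> y"
    using assms(2,3) adj_in_verts[OF uv(1)] by (metis inj_onD)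
qed (use assms(1) in \<open>auto simp: pair_isomorphism_def\<close>)

context nomulti_digraph
begin

lemma card_arcs_ends: "card (arcs_ends G) = card (arcs G)"
  unfolding arcs_ends_def by (rule card_image) (rule inj_on_arc_to_ends)

lemma card_map_prod_arcs_ends:
  assumes "inj_on f (verts G)"
  shows "card (map_prod f f ` arcs_ends G) = card (arcs G)"
proof -
  have "arcs_ends G \<subseteq> verts G \<times> verts G" using adj_in_verts by auto
  then have "inj_on (map_prod f f) (arcs_ends G)"
    by (rule inj_on_subset[OF map_prod_inj_on[OF assms assms]])
  then show ?thesis by (simp add: card_image card_arcs_ends)
qed

lemma arc_embedding_card_arcs_le:
  assumes "arc_embedding f H" "finite (parcs H)"
  shows "card (arcs G) \<le> card (parcs H)"
  using assms card_map_prod_arcs_ends card_mono unfolding arc_embedding_def by metis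

lemma arc_embedding_pair_isomorphism:
  assumes emb: "arc_embedding f H" and "finite (parcs H)"
    and "card (arcs G) = card (parcs H)"
    and cover: "pverts H \<subseteq> f ` verts G \<union> Field (parcs H)"
  shows "pair_isomorphism f H"
proof -
  have inj: "inj_on f (verts G)" using emb by (simp add: arc_embedding_def)
  have arcs: "map_prod f f ` arcs_ends G = parcs H"
    using assms(1-3) card_map_prod_arcs_ends[OF inj]
    by (intro card_subset_eq) (auto simp: arc_embedding_def)
  then have "Field (parcs H) \<subseteq> f ` verts G"
    using adj_in_verts by (fastforce simp: Field_def)
  then have "f ` verts G = pverts H" using emb cover by (auto simp: arc_embedding_def)
  then show ?thesis using inj arcs by (simp add: pair_isomorphism_def bij_betw_def)
qed

lemma pair_isomorphism_digraph_iso: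
  assumes iso: "pair_isomorphism f H"
  shows "digraph_iso G (with_proj H)"
proof -
  define hom where "hom = \<lparr>iso_verts = f, iso_arcs = (\<lambda>e. (f (tail G e), f (head G e))),
    iso_head = snd, iso_tail = fst\<rparr>"
  have bij: "bij_betw f (verts G) (pverts H)" using iso by (simp add: pair_isomorphism_def)
  then have inj: "inj_on f (verts G)" by (rule bij_betw_imp_inj_on)
  have "inj_on (iso_arcs hom) (arcs G)"
  proof (rule inj_onI)
    fix e e' assume e: "e \<in> arcs G" "e' \<in> arcs G" "iso_arcs hom e = iso_arcs hom e'"
    then have "tail G e = tail G e'" "head G e = head G e'"
      using inj by (auto simp: hom_def dest: inj_onD)
    then show "e = e'" using e by (auto intro: no_multi_arcs simp: arc_to_ends_def)
  qed
  then have "digraph_isomorphism hom"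
    using inj wf_digraph unfolding digraph_isomorphism_def by (simp add: hom_def)
  moreover have "with_proj H = app_iso hom G"
    using iso bij_betw_imp_surj_on[OF bij]
    unfolding with_proj_def app_iso_def hom_def arcs_ends_conv pair_isomorphism_def
    by (auto simp: image_image)
  ultimately show ?thesis unfolding digraph_iso_def by blast
qed

end

lemma card_parcs_directed_cycle: "card (parcs (directed_cycle n)) = n"
proof -
  have "parcs (directed_cycle n) = (\<lambda>i. (i, Suc i mod n)) ` {..<n}"
    by (auto simp: directed_cycle_def)
  then show ?thesis by (simp add: card_image inj_on_def)
qed

lemma finite_parcs_directed_cycle: "finite (parcs (directed_cycle n))"
  by (simp add: directed_cycle_def)

lemma card_Times_minus_Id:
  assumes "finite A"
  shows "card (A \<times> A - Id) = card A * (card A - 1)"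
proof -
  have "A \<times> A - Id = (SIGMA x:A. A - {x})" by auto
  then show ?thesis using assms by simp
qed

lemma parcs_standard_complete: "parcs (standard_complete n) = {..<n} \<times> {..<n} - Id"
  by (auto simp: standard_complete_def)

lemma card_parcs_standard_complete: "card (parcs (standard_complete n)) = n * (n - 1)"
  by (simp add: parcs_standard_complete card_Times_minus_Id)

lemma (in digraph) digraph_iso_standard_complete:
  assumes "card (arcs G) = card (verts G) * (card (verts G) - 1)"
  shows "digraph_iso G (with_proj (standard_complete (card (verts G))))"
proof -
  let ?K = "standard_complete (card (verts G))"
  obtain f where f: "bij_betw f (verts G) {..<card (verts G)}"
    using ex_bij_betw_finite_nat[OF finite_verts] by (metis atLeast0LessThan)
  have "arc_embedding f ?K"
  proof (rule arc_embeddingI)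
    fix x y assume xy: "x \<rightarrow> y"
    then have "f x \<noteq> f y"
      using f adj_in_verts[OF xy] adj_not_same by (auto simp: bij_betw_def dest: inj_onD)
    then show "(f x, f y) \<in> parcs ?K"
      using f adj_in_verts[OF xy] by (auto simp: standard_complete_def dest: bij_betwE)
  qed (use f in \<open>auto simp: standard_complete_def bij_betw_def\<close>)
  moreover have "pverts ?K = f ` verts G"
    using f by (simp add: standard_complete_def bij_betw_def)
  ultimately have "pair_isomorphism f ?K"
    using assms
    by (intro arc_embedding_pair_isomorphism)
      (simp_all add: card_parcs_standard_complete, simp add: parcs_standard_complete)
  then show ?thesis by (rule pair_isomorphism_digraph_iso)
qed

subsection \<open>Distances\<close>

context wf_digraph
begin

lemma length_awalk_to_apath_le:
  assumes "awalk u p v"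
  shows "length (awalk_to_apath p) \<le> length p"
  using assms
proof (induction rule: awalk_to_apath_induct)
  case (path p)
  then have "awalk_to_apath p = p" by (auto simp: awalk_to_apath.simps)
  then show ?case by simp
next
  case (decomp p q r s)
  then have "length (q @ s) \<le> length p"
    using awalk_cyc_decomp_has_prop[OF decomp(1,3)] by auto
  then show ?case using decomp step_awalk_to_apath[OF decomp(1-3)] by simp
qed

lemma ddist_le_length:
  assumes "awalk u p v"
  shows "ddist u v \<le> length p"
proof -
  have "ddist u v \<le> length (awalk_to_apath p)"
    unfolding ddist_def using apath_awalk_to_apath[OF assms] by (intro Least_le) blast
  then show ?thesis using length_awalk_to_apath_le[OF assms] by simp
qed

lemma ddist_awalkE:
  assumes "u \<rightarrow>\<^sup>* v"
  obtains p where "awalk u p v" "length p = ddist u v"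
proof -
  obtain q where "apath u q v" using assms by (auto simp: reachable_apath)
  then have "\<exists>n p. apath u p v \<and> length p = n" by blast
  then have "\<exists>p. apath u p v \<and> length p = ddist u v" unfolding ddist_def by (rule LeastI_ex)
  then show ?thesis using that by (auto simp: apath_def)
qed

lemma ddist_self: "u \<in> verts G \<Longrightarrow> ddist u u = 0"
  using ddist_le_length[of u "[]" u] by (simp add: awalk_Nil_iff)

lemma ddist_eq_0_iff:
  assumes "u \<rightarrow>\<^sup>* v"
  shows "ddist u v = 0 \<longleftrightarrow> u = v"
proof
  assume "ddist u v = 0"
  with ddist_awalkE[OF assms] show "u = v" by (metis length_0_conv awalk_empty_ends)
next
  assume "u = v"
  then show "ddist u v = 0" using assms by (simp add: ddist_self reachable_in_verts)
qed

lemma ddist_triangle: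
  assumes "u \<rightarrow>\<^sup>* v" "v \<rightarrow>\<^sup>* w"
  shows "ddist u w \<le> ddist u v + ddist v w"
proof -
  obtain p where p: "awalk u p v" "length p = ddist u v" by (rule ddist_awalkE[OF assms(1)])
  obtain q where q: "awalk v q w" "length q = ddist v w" by (rule ddist_awalkE[OF assms(2)])
  show ?thesis using ddist_le_length[OF awalk_appendI[OF p(1) q(1)]] p q by simp
qed

lemma ddist_adj_le_1:
  assumes "u \<rightarrow> v"
  shows "ddist u v \<le> 1"
proof -
  obtain e where "e \<in> arcs G" "tail G e = u" "head G e = v" using assms by blast
  then show ?thesis using ddist_le_length[of u "[e]" v] by (auto simp: awalk_simps)
qed

lemma ddist_from_adj_le:
  assumes "w \<rightarrow>\<^sup>* x" "x \<rightarrow> y"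
  shows "ddist w y \<le> Suc (ddist w x)"
  using ddist_triangle[of w x y] ddist_adj_le_1[of x y] assms by auto

lemma ddist_to_adj_le:
  assumes "x \<rightarrow> y" "y \<rightarrow>\<^sup>* w"
  shows "ddist x w \<le> Suc (ddist y w)"
  using ddist_triangle[of x y w] ddist_adj_le_1[of x y] assms by auto

lemma geodesic_predecessor:
  assumes "u \<rightarrow>\<^sup>* v" "u \<noteq> v"
  obtains w where "u \<rightarrow>\<^sup>* w" "w \<rightarrow> v" "ddist u v = Suc (ddist u w)"
proof -
  obtain p where p: "awalk u p v" "length p = ddist u v" by (rule ddist_awalkE[OF assms(1)])
  then have "p \<noteq> []" using assms(2) by (auto simp: awalk_Nil_iff)
  then obtain q e where "p = q @ [e]" by (metis append_butlast_last_id)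
  with p have q: "awalk u q (tail G e)" "ddist u v = Suc (length q)" "e \<in> arcs G" "head G e = v"
    by (auto simp: awalk_Cons_iff awalk_Nil_iff)
  then have "tail G e \<rightarrow> v" by (auto simp: arcs_ends_conv)
  moreover have "u \<rightarrow>\<^sup>* tail G e" using q(1) by (rule reachable_awalkI)
  moreover have "ddist u v = Suc (ddist u (tail G e))"
    using ddist_from_adj_le[OF calculation(2,1)] ddist_le_length[OF q(1)] q(2) by simp
  ultimately show ?thesis by (intro that)
qed

lemma atMost_ddist_subset_image:
  assumes "u \<rightarrow>\<^sup>* v"
  shows "{..ddist u v} \<subseteq> ddist u ` verts G"
  using assms
proof (induction "ddist u v" arbitrary: v)
  case 0
  then show ?case using reachable_in_verts(2)[OF 0(2)] by auto
next
  case (Suc n)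
  then have "u \<noteq> v" using ddist_eq_0_iff by fastforce
  then obtain w where "u \<rightarrow>\<^sup>* w" "ddist u v = Suc (ddist u w)"
    using geodesic_predecessor[OF Suc.prems] by blast
  then have "{..n} \<subseteq> ddist u ` verts G" using Suc.hyps by simp
  moreover have "{..ddist u v} = insert (ddist u v) {..n}"
    using Suc.hyps(2) by (metis atMost_Suc)
  ultimately show ?case using reachable_in_verts(2)[OF Suc.prems] by simp
qed

end

lemma (in loopfree_digraph) ddist_adj:
  assumes "u \<rightarrow> v"
  shows "ddist u v = 1"
  using ddist_adj_le_1[OF assms] ddist_eq_0_iff[of u v] assms adj_not_same by fastforce

locale strongly_connected_digraph = digraph G for G :: "('a, 'b) pre_digraph" (structure) +
  assumes strongly_connected: "strongly_connected G"
begin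

lemma reachable_verts: "u \<in> verts G \<Longrightarrow> v \<in> verts G \<Longrightarrow> u \<rightarrow>\<^sup>* v"
  using strongly_connected by (simp add: strongly_connected_def)

lemma finite_ddists: "finite {ddist u v | u v. u \<in> verts G \<and> v \<in> verts G}"
  using finite_image_set2[of "\<lambda>u. u \<in> verts G" "\<lambda>v. v \<in> verts G" ddist] by simp

lemma ddist_le_diam: "u \<in> verts G \<Longrightarrow> v \<in> verts G \<Longrightarrow> ddist u v \<le> diam"
  unfolding diam_def by (intro Max_ge[OF finite_ddists]) blast

lemma diam_attained:
  obtains u v where "u \<in> verts G" "v \<in> verts G" "ddist u v = diam"
proof -
  have "verts G \<noteq> {}" using strongly_connected by (simp add: strongly_connected_def)
  then have "diam \<in> {ddist u v | u v. u \<in> verts G \<and> v \<in> verts G}"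
    unfolding diam_def by (intro Max_in[OF finite_ddists]) auto
  then show ?thesis using that by auto
qed

lemma ex_other_vertex:
  assumes "diam \<ge> 1"
  obtains v where "v \<in> verts G" "v \<noteq> u"
proof -
  obtain x y where "x \<in> verts G" "y \<in> verts G" "ddist x y = diam" by (rule diam_attained)
  then show ?thesis using assms that ddist_self by (metis not_one_le_zero)
qed

subsection \<open>The lower bound\<close>

text \<open>The vertex \<open>x\<close> tells the deleted vertices apart, and each remaining vertex is told apart from all
  others by its distance 0 to itself.\<close>

lemma weakly_resolving_Diff:
  assumes x: "x \<in> verts G - S" and inj: "inj_on (ddist x) S"
  shows "weakly_resolving (verts G - S)"
  unfolding weakly_resolving_def
proof (intro conjI ballI impI)
  fix u v assume uv: "u \<in> verts G" "v \<in> verts G" "u \<noteq> v"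
  then have "ddist u u = 0" "ddist v v = 0" "ddist u v \<noteq> 0" "ddist v u \<noteq> 0"
    by (simp_all add: ddist_eq_0_iff reachable_verts)
  moreover have "ddist x u \<noteq> ddist x v" if "u \<in> S" "v \<in> S"
    using that uv(3) inj by (auto dest: inj_onD)
  ultimately show "\<exists>w\<in>verts G - S. two_way_dist w u \<noteq> two_way_dist w v"
    using uv x unfolding two_way_dist_def by (metis DiffI prod.inject)
qed auto

lemma weak_dim_attained:
  obtains W where "weakly_resolving W" "card W = weak_dim"
proof -
  obtain x where "x \<in> verts G" by (rule diam_attained)
  then have "weakly_resolving (verts G - {})" by (intro weakly_resolving_Diff) auto
  then have "\<exists>m W. weakly_resolving W \<and> card W = m" by blast
  then have "\<exists>W. weakly_resolving W \<and> card W = weak_dim" unfolding weak_dim_def by (rule LeastI_ex)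
  then show ?thesis using that by blast
qed

lemma weak_dim_le: "weakly_resolving W \<Longrightarrow> weak_dim \<le> card W"
  unfolding weak_dim_def by (rule Least_le) blast

lemma weak_dim_add_diam_le: "weak_dim + diam \<le> card (verts G)"
proof -
  obtain x y where xy: "x \<in> verts G" "y \<in> verts G" "ddist x y = diam" by (rule diam_attained)
  then have "{1..diam} \<subseteq> ddist x ` verts G"
    using atMost_ddist_subset_image[OF reachable_verts, of x y] by auto
  then obtain S where S: "S \<subseteq> verts G" "inj_on (ddist x) S" "ddist x ` S = {1..diam}"
    unfolding subset_image_inj by metis
  then have card: "card S = diam" by (metis card_image card_atLeastAtMost diff_Suc_1)
  have "x \<notin> S" using S(3) ddist_self[OF xy(1)] by (metis atLeastAtMost_iff imageI not_one_le_zero)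
  then have "weak_dim \<le> card (verts G - S)"
    using S(2) xy(1) by (intro weak_dim_le weakly_resolving_Diff) auto
  moreover have "card (verts G - S) + card S = card (verts G)"
    using S(1) by (simp add: card_Diff_subset card_mono finite_subset)
  ultimately show ?thesis using card by simp
qed

lemma tail_image_arcs:
  assumes "diam \<ge> 1"
  shows "tail G ` arcs G = verts G"
proof
  show "verts G \<subseteq> tail G ` arcs G"
  proof
    fix u assume u: "u \<in> verts G"
    obtain v where "v \<in> verts G" "v \<noteq> u" using assms by (rule ex_other_vertex)
    then obtain w where "u \<rightarrow> w" using u reachable_verts converse_reachable_cases by metis
    then show "u \<in> tail G ` arcs G" by auto
  qed
qed auto

lemma card_verts_le_card_arcs:
  assumes "diam \<ge> 1"
  shows "card (verts G) \<le> card (arcs G)"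
  using card_image_le[OF finite_arcs, of "tail G"] tail_image_arcs[OF assms] by simp

lemma weak_dim_add_diam_le_card_arcs:
  assumes "diam \<ge> 1"
  shows "weak_dim + diam \<le> card (arcs G)"
  using weak_dim_add_diam_le card_verts_le_card_arcs[OF assms] by simp

lemma single_valued_arcs_ends:
  assumes "diam \<ge> 1" "card (arcs G) = card (verts G)"
  shows "single_valued (arcs_ends G)"
proof -
  have "inj_on (tail G) (arcs G)"
    using assms tail_image_arcs by (simp add: eq_card_imp_inj_on)
  then show ?thesis by (auto simp: single_valued_def arcs_ends_conv dest: inj_onD)
qed

lemma single_valued_inj_on_ddist:
  assumes sv: "single_valued (arcs_ends G)" and v: "v \<in> verts G"
  shows "inj_on (ddist v) (verts G)"
proof (rule inj_onI)
  fix x y assume "x \<in> verts G" "y \<in> verts G" "ddist v x = ddist v y"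
  then show "x = y"
  proof (induction "ddist v x" arbitrary: x y)
    case 0
    then show ?case using v ddist_eq_0_iff reachable_verts by metis
  next
    case (Suc n)
    then have "v \<noteq> x" "v \<noteq> y" using ddist_self[OF v] by auto
    obtain x' where x': "v \<rightarrow>\<^sup>* x'" "x' \<rightarrow> x" "ddist v x = Suc (ddist v x')"
      using geodesic_predecessor[OF reachable_verts] v Suc.prems \<open>v \<noteq> x\<close> by metis
    obtain y' where y': "v \<rightarrow>\<^sup>* y'" "y' \<rightarrow> y" "ddist v y = Suc (ddist v y')"
      using geodesic_predecessor[OF reachable_verts] v Suc.prems \<open>v \<noteq> y\<close> by metis
    have "x' = y'" using Suc x' y' reachable_in_verts(2) by auto
    then show ?case using x'(2) y'(2) sv by (auto dest: single_valuedD)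
  qed
qed

lemma single_valued_image_ddist:
  assumes sv: "single_valued (arcs_ends G)" and v: "v \<in> verts G"
  shows "ddist v ` verts G = {..<card (verts G)}"
proof (rule card_subset_eq)
  have card: "card (ddist v ` verts G) = card (verts G)"
    using single_valued_inj_on_ddist[OF assms] by (rule card_image)
  then show "card (ddist v ` verts G) = card {..<card (verts G)}" by simp
  show "ddist v ` verts G \<subseteq> {..<card (verts G)}"
  proof (rule image_subsetI)
    fix x assume "x \<in> verts G"
    then have "card {..ddist v x} \<le> card (ddist v ` verts G)"
      using v by (intro card_mono atMost_ddist_subset_image reachable_verts) auto
    then show "ddist v x \<in> {..<card (verts G)}" using card by simp
  qed
qed simp

lemma single_valued_ddist_adj_Suc:
  assumes sv: "single_valued (arcs_ends G)" and v: "v \<in> verts G"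
    and adj: "x \<rightarrow> y" and less: "Suc (ddist v x) < card (verts G)"
  shows "ddist v y = Suc (ddist v x)"
proof -
  have "Suc (ddist v x) \<in> ddist v ` verts G"
    using less single_valued_image_ddist[OF sv v] by simp
  then obtain z where z: "z \<in> verts G" "ddist v z = Suc (ddist v x)" by auto
  then obtain p where p: "p \<rightarrow> z" "ddist v z = Suc (ddist v p)"
    using geodesic_predecessor[OF reachable_verts] v ddist_self by (metis nat.distinct(1))
  then have "p = x"
    using z(2) adj_in_verts(1)[OF p(1)] adj_in_verts(1)[OF adj] single_valued_inj_on_ddist[OF sv v]
    by (auto dest: inj_onD)
  then have "z = y" using p(1) adj sv by (auto dest: single_valuedD)
  then show ?thesis using z(2) by simp
qed

text \<open>The arc into \<open>v\<close> starts at the vertex farthest from \<open>v\<close>, since from every other vertex the only arc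
  leads one step farther away.\<close>

lemma single_valued_ddist_adj_mod:
  assumes sv: "single_valued (arcs_ends G)" and v: "v \<in> verts G" and adj: "x \<rightarrow> y"
  shows "ddist v y = Suc (ddist v x) mod card (verts G)"
proof -
  let ?n = "card (verts G)"
  have less: "ddist v p < ?n" if "p \<in> verts G" for p
    using single_valued_image_ddist[OF sv v] that by blast
  consider "Suc (ddist v x) < ?n" | "Suc (ddist v x) = ?n"
    using less[OF adj_in_verts(1)[OF adj]] by linarith
  then show ?thesis
  proof cases
    case 1
    then show ?thesis using single_valued_ddist_adj_Suc[OF sv v adj] by simp
  next
    case 2
    obtain u where u: "u \<in> verts G" "u \<noteq> v" using adj_in_verts[OF adj] adj adj_not_same by metis
    then obtain p where p: "p \<rightarrow> v" using geodesic_predecessor[OF reachable_verts] v by metis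
    then have "\<not> Suc (ddist v p) < ?n"
      using single_valued_ddist_adj_Suc[OF sv v p] ddist_self[OF v] by auto
    then have "ddist v p = ddist v x" using less[OF adj_in_verts(1)[OF p]] 2 by linarith
    then have "p = x"
      using single_valued_inj_on_ddist[OF sv v] adj_in_verts(1)[OF p] adj_in_verts(1)[OF adj]
      by (auto dest: inj_onD)
    then have "y = v" using sv p adj by (auto dest: single_valuedD)
    then show ?thesis using 2 ddist_self[OF v] by simp
  qed
qed

lemma digraph_iso_directed_cycle:
  assumes "diam \<ge> 1" "card (arcs G) = card (verts G)"
  shows "digraph_iso G (with_proj (directed_cycle (card (verts G))))"
proof -
  let ?C = "directed_cycle (card (verts G))"
  have sv: "single_valued (arcs_ends G)" using assms by (rule single_valued_arcs_ends)
  obtain v where v: "v \<in> verts G" by (rule diam_attained)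
  have image: "ddist v ` verts G = pverts ?C"
    using single_valued_image_ddist[OF sv v] by (simp add: directed_cycle_def)
  have "arc_embedding (ddist v) ?C"
  proof (rule arc_embeddingI)
    show "inj_on (ddist v) (verts G)" using sv v by (rule single_valued_inj_on_ddist)
  next
    fix x assume "x \<in> verts G"
    then show "ddist v x \<in> pverts ?C" using image by blast
  next
    fix x y assume adj: "x \<rightarrow> y"
    then have "ddist v x < card (verts G)" using adj_in_verts[OF adj] single_valued_image_ddist[OF sv v] by blast
    then show "(ddist v x, ddist v y) \<in> parcs ?C"
      using single_valued_ddist_adj_mod[OF sv v adj] by (simp add: directed_cycle_def)
  qed
  then have "pair_isomorphism (ddist v) ?C"
    using assms(2) image
    by (intro arc_embedding_pair_isomorphism)
      (auto simp: card_parcs_directed_cycle finite_parcs_directed_cycle)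
  then show ?thesis by (rule pair_isomorphism_digraph_iso)
qed

lemma single_valued_weak_dim_le_1:
  assumes "single_valued (arcs_ends G)"
  shows "weak_dim \<le> 1"
proof -
  obtain v where v: "v \<in> verts G" by (rule diam_attained)
  then have "inj_on (ddist v) (verts G - {v})"
    using single_valued_inj_on_ddist[OF assms] inj_on_subset by blast
  then have "weakly_resolving (verts G - (verts G - {v}))"
    using v by (intro weakly_resolving_Diff) auto
  moreover have "verts G - (verts G - {v}) = {v}" using v by auto
  ultimately show ?thesis using weak_dim_le by fastforce
qed

lemma card_arcs_eq_weak_dim_add_diam_iff:
  assumes "weak_dim \<ge> 1" "diam \<ge> 1"
  shows "card (arcs G) = weak_dim + diam \<longleftrightarrow>
    weak_dim = 1 \<and> digraph_iso G (with_proj (directed_cycle (diam + 1)))"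
proof
  assume eq: "card (arcs G) = weak_dim + diam"
  then have n: "card (arcs G) = card (verts G)"
    using weak_dim_add_diam_le card_verts_le_card_arcs[OF assms(2)] by simp
  then have "weak_dim = 1"
    using single_valued_weak_dim_le_1 single_valued_arcs_ends assms by fastforce
  then show "weak_dim = 1 \<and> digraph_iso G (with_proj (directed_cycle (diam + 1)))"
    using digraph_iso_directed_cycle[OF assms(2) n] n eq by simp
next
  assume "weak_dim = 1 \<and> digraph_iso G (with_proj (directed_cycle (diam + 1)))"
  then show "card (arcs G) = weak_dim + diam"
    using digraph_iso_card_arcs card_parcs_directed_cycle by fastforce
qed

end

subsection \<open>Counting the arcs of the extremal digraph\<close>

lemma ball_atLeastAtMost_double:
  "(\<forall>j\<in>{1..2 * k}. P j) \<longleftrightarrow> (\<forall>r\<in>{1..k}. P (2 * r - 1) \<and> P (2 * r))" for k :: nat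
proof -
  have "j \<in> (\<lambda>r. 2 * r - 1) ` {1..k} \<union> (\<lambda>r. 2 * r) ` {1..k}" if "j \<in> {1..2 * k}" for j
  proof (cases "even j")
    case True
    then show ?thesis using that by (auto elim!: evenE)
  next
    case False
    then obtain r where "j = 2 * Suc r - 1" by (auto elim!: oddE)
    then show ?thesis using that by (intro UnI1 image_eqI[of _ _ "Suc r"]) auto
  qed
  moreover have "(\<lambda>r. 2 * r - 1) ` {1..k} \<union> (\<lambda>r. 2 * r) ` {1..k} \<subseteq> {1..2 * k}" by auto
  ultimately have "{1..2 * k} = (\<lambda>r. 2 * r - 1) ` {1..k} \<union> (\<lambda>r. 2 * r) ` {1..k}" by blast
  then show ?thesis by auto
qed

lemma card_PiE_fixed_value:
  assumes "finite I" "j \<in> I" "c \<in> A j"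
  shows "card {f \<in> PiE I A. f j = c} = (\<Prod>i\<in>I - {j}. card (A i))"
proof -
  have "{f \<in> PiE I A. f j = c} = PiE I (A(j := {c}))"
    using assms(2,3) by (auto simp: PiE_iff extensional_def split: if_splits)
  then have "card {f \<in> PiE I A. f j = c} = (\<Prod>i\<in>I. card ((A(j := {c})) i))"
    using assms(1) by (simp add: card_PiE)
  also have "\<dots> = (\<Prod>i\<in>I - {j}. card ((A(j := {c})) i))"
    using assms(1,2) by (simp add: prod.remove[of _ j])
  also have "\<dots> = (\<Prod>i\<in>I - {j}. card (A i))" by (intro prod.cong) auto
  finally show ?thesis .
qed

lemma card_PiE_pointwise_related:
  assumes "finite I" and R: "\<And>i. i \<in> I \<Longrightarrow> R i \<subseteq> A i \<times> B i"
  shows "card {(f, g). f \<in> PiE I A \<and> g \<in> PiE I B \<and> (\<forall>i\<in>I. (f i, g i) \<in> R i)}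
    = (\<Prod>i\<in>I. card (R i))" (is "card ?Q = _")
proof -
  have "bij_betw (\<lambda>(f, g). \<lambda>i\<in>I. (f i, g i)) ?Q (PiE I R)"
  proof (rule bij_betw_byWitness[where f' = "\<lambda>h. (\<lambda>i\<in>I. fst (h i), \<lambda>i\<in>I. snd (h i))"])
    show "(\<lambda>h. (\<lambda>i\<in>I. fst (h i), \<lambda>i\<in>I. snd (h i))) ` PiE I R \<subseteq> ?Q"
    proof (rule image_subsetI)
      fix h assume "h \<in> PiE I R"
      then have h: "h i \<in> R i" if "i \<in> I" for i using that by auto
      then have "fst (h i) \<in> A i" "snd (h i) \<in> B i" if "i \<in> I" for i
        using that R by (force simp: mem_Times_iff)+
      then show "(\<lambda>i\<in>I. fst (h i), \<lambda>i\<in>I. snd (h i)) \<in> ?Q" using h by simp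
    qed
  qed (auto simp: fun_eq_iff PiE_def extensional_def)
  then have "card ?Q = card (PiE I R)" by (rule bij_betw_same_card)
  then show ?thesis using assms(1) by (simp add: card_PiE)
qed

definition step_pairs :: "nat \<Rightarrow> (nat \<times> nat) set" where
  "step_pairs d = {(x, y). x \<in> {1..d} \<and> y \<in> {1..d} \<and> y \<le> Suc x}"

lemma step_pairs_subset: "step_pairs d \<subseteq> {1..d} \<times> {1..d}"
  by (auto simp: step_pairs_def)

lemma card_step_pairs:
  assumes "d \<ge> 1"
  shows "real (card (step_pairs d)) = (real d ^ 2 + 3 * real d - 2) / 2"
  using assms
proof (induction d rule: nat_induct_at_least)
  case base
  have "step_pairs 1 = {(1, 1)}" by (auto simp: step_pairs_def)
  then show ?case by simp
next
  case (Suc d)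
  let ?new = "{Suc d} \<times> {1..Suc d} \<union> {(d, Suc d)}"
  have "step_pairs (Suc d) = step_pairs d \<union> ?new"
    using Suc.hyps by (auto simp: step_pairs_def)
  moreover have "finite (step_pairs d)" by (rule finite_subset[OF step_pairs_subset]) simp
  moreover have "step_pairs d \<inter> ?new = {}" by (auto simp: step_pairs_def)
  ultimately have "card (step_pairs (Suc d)) = card (step_pairs d) + card ?new"
    by (simp add: card_Un_disjoint)
  also have "card ?new = Suc d + 1" by (subst card_Un_disjoint) auto
  finally show ?case using Suc.IH by (simp add: power2_eq_square field_simps)
qed

lemma finite_tuples: "finite (tuples k d)"
  unfolding tuples_def by (intro finite_PiE) auto

lemma card_tuples: "card (tuples k d) = d ^ (2 * k)"
  unfolding tuples_def by (simp add: card_PiE)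

lemma tuples_mem: "a \<in> tuples k d \<Longrightarrow> j \<in> {1..2 * k} \<Longrightarrow> a j \<in> {1..d}"
  unfolding tuples_def by (rule PiE_mem)

lemma card_SIGMA_tuples_coordinate_1:
  assumes "d \<ge> 1" and "\<And>i. i \<in> {1..k} \<Longrightarrow> h i \<in> {1..2 * k}"
  shows "card (SIGMA i:{1..k}. {a \<in> tuples k d. a (h i) = 1}) = k * d ^ (2 * k - 1)"
proof -
  have "card {a \<in> tuples k d. a (h i) = 1} = d ^ (2 * k - 1)" if "i \<in> {1..k}" for i
    using assms(1) assms(2)[OF that] unfolding tuples_def
    by (subst card_PiE_fixed_value) auto
  then show ?thesis using finite_tuples by simp
qed

definition tuple_steps :: "nat \<Rightarrow> nat \<Rightarrow> ((nat \<Rightarrow> nat) \<times> (nat \<Rightarrow> nat)) set" where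
  "tuple_steps k d = {(a, b). a \<in> tuples k d \<and> b \<in> tuples k d \<and>
    (\<forall>r\<in>{1..k}. b (2 * r - 1) \<le> Suc (a (2 * r - 1)) \<and> a (2 * r) \<le> Suc (b (2 * r)))}"

lemma finite_tuple_steps: "finite (tuple_steps k d)"
  by (rule finite_subset[of _ "tuples k d \<times> tuples k d"]) (auto simp: tuple_steps_def finite_tuples)

lemma card_tuple_steps: "card (tuple_steps k d) = card (step_pairs d) ^ (2 * k)"
proof -
  define R where "R j = (if odd j then step_pairs d else (step_pairs d)\<inverse>)" for j :: nat
  have card_R: "card (R j) = card (step_pairs d)" for j by (simp add: R_def)
  have "(\<forall>r\<in>{1..k}. b (2 * r - 1) \<le> Suc (a (2 * r - 1)) \<and> a (2 * r) \<le> Suc (b (2 * r))) \<longleftrightarrow>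
      (\<forall>j\<in>{1..2 * k}. (a j, b j) \<in> R j)"
    if "a \<in> tuples k d" "b \<in> tuples k d" for a b
    unfolding ball_atLeastAtMost_double
  proof (rule ball_cong[OF refl])
    fix r assume "r \<in> {1..k}"
    then have "odd (2 * r - 1)" "2 * r - 1 \<in> {1..2 * k}" "2 * r \<in> {1..2 * k}" by auto
    then show "b (2 * r - 1) \<le> Suc (a (2 * r - 1)) \<and> a (2 * r) \<le> Suc (b (2 * r)) \<longleftrightarrow>
        (a (2 * r - 1), b (2 * r - 1)) \<in> R (2 * r - 1) \<and> (a (2 * r), b (2 * r)) \<in> R (2 * r)"
      using tuples_mem[OF that(1)] tuples_mem[OF that(2)] by (simp add: R_def step_pairs_def)
  qed
  then have "tuple_steps k d =
      {(a, b). a \<in> tuples k d \<and> b \<in> tuples k d \<and> (\<forall>j\<in>{1..2 * k}. (a j, b j) \<in> R j)}"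
    unfolding tuple_steps_def by blast
  also have "card \<dots> = (\<Prod>j\<in>{1..2 * k}. card (R j))"
    unfolding tuples_def using step_pairs_subset
    by (intro card_PiE_pointwise_related) (auto simp: R_def)
  also have "\<dots> = card (step_pairs d) ^ (2 * k)" by (simp add: card_R)
  finally show ?thesis .
qed

lemma card_tuple_steps_minus_Id:
  assumes "d \<ge> 1"
  shows "real (card (tuple_steps k d - Id))
    = ((real d ^ 2 + 3 * real d - 2) / 2) ^ (2 * k) - real d ^ (2 * k)"
proof -
  have "tuple_steps k d - Id = tuple_steps k d - Id_on (tuples k d)"
    by (auto simp: tuple_steps_def)
  moreover have "Id_on (tuples k d) \<subseteq> tuple_steps k d" by (auto simp: tuple_steps_def)
  moreover have "card (Id_on (tuples k d)) = d ^ (2 * k)"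
    by (simp add: Id_on_def card_tuples UNION_singleton_eq_range card_image inj_on_def)
  ultimately have "card (tuple_steps k d - Id) + d ^ (2 * k) = card (step_pairs d) ^ (2 * k)"
    using finite_tuple_steps card_mono[OF finite_tuple_steps]
    by (metis card_Diff_subset card_tuple_steps finite_subset le_add_diff_inverse2)
  then have "real (card (tuple_steps k d - Id)) + real d ^ (2 * k) = real (card (step_pairs d)) ^ (2 * k)"
    by (simp flip: of_nat_add of_nat_power)
  then show ?thesis using card_step_pairs[OF assms] by simp
qed

lemma parcs_Gamma_digraph:
  "parcs (Gamma_digraph k d) =
    (\<lambda>(i, a). (U i, Tup a)) ` (SIGMA i:{1..k}. {a \<in> tuples k d. a (2 * i - 1) = 1}) \<union>
    (\<lambda>(i, a). (Tup a, U i)) ` (SIGMA i:{1..k}. {a \<in> tuples k d. a (2 * i) = 1}) \<union>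
    map_prod Tup Tup ` (tuple_steps k d - Id)"
proof -
  have "int a - int b \<ge> -1 \<longleftrightarrow> b \<le> Suc a" "int a - int b \<le> 1 \<longleftrightarrow> a \<le> Suc b" for a b by linarith+
  then show ?thesis unfolding Gamma_digraph_def tuple_steps_def by (auto simp: image_iff)
qed

lemma parcs_Gamma_bar_digraph:
  "parcs (Gamma_bar_digraph k d) =
    parcs (Gamma_digraph k d) \<union> map_prod U U ` ({1..k} \<times> {1..k} - Id)"
  unfolding Gamma_bar_digraph_def by auto

lemma Gamma_bar_arc_iff [simp]:
  "(U i, U j) \<in> parcs (Gamma_bar_digraph k d) \<longleftrightarrow> i \<in> {1..k} \<and> j \<in> {1..k} \<and> i \<noteq> j"
  "(U i, Tup a) \<in> parcs (Gamma_bar_digraph k d) \<longleftrightarrow> i \<in> {1..k} \<and> a \<in> tuples k d \<and> a (2 * i - 1) = 1"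
  "(Tup a, U i) \<in> parcs (Gamma_bar_digraph k d) \<longleftrightarrow> i \<in> {1..k} \<and> a \<in> tuples k d \<and> a (2 * i) = 1"
  "(Tup a, Tup b) \<in> parcs (Gamma_bar_digraph k d) \<longleftrightarrow> (a, b) \<in> tuple_steps k d \<and> a \<noteq> b"
  unfolding parcs_Gamma_bar_digraph parcs_Gamma_digraph by auto

lemma pverts_Gamma_bar_digraph:
  "pverts (Gamma_bar_digraph k d) = U ` {1..k} \<union> Tup ` tuples k d"
  by (simp add: Gamma_bar_digraph_def Gamma_digraph_def)

lemma finite_parcs_Gamma_digraph: "finite (parcs (Gamma_digraph k d))"
  unfolding parcs_Gamma_digraph using finite_tuples finite_tuple_steps by auto

lemma finite_parcs_Gamma_bar_digraph: "finite (parcs (Gamma_bar_digraph k d))"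
  unfolding parcs_Gamma_bar_digraph using finite_parcs_Gamma_digraph by simp

lemma card_parcs_Gamma_digraph:
  assumes "d \<ge> 1" "k \<ge> 1"
  shows "real (card (parcs (Gamma_digraph k d)))
    = ((real d ^ 2 + 3 * real d - 2) / 2) ^ (2 * k) + (2 * real k - real d) * real d ^ (2 * k - 1)"
proof -
  define from_U where "from_U = (\<lambda>(i, a). (U i, Tup a)) `
    (SIGMA i:{1..k}. {a \<in> tuples k d. a (2 * i - 1) = 1})"
  define to_U where "to_U = (\<lambda>(i, a). (Tup a, U i)) `
    (SIGMA i:{1..k}. {a \<in> tuples k d. a (2 * i) = 1})"
  define steps where "steps = map_prod Tup Tup ` (tuple_steps k d - Id)"
  have parcs: "parcs (Gamma_digraph k d) = from_U \<union> to_U \<union> steps"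
    unfolding parcs_Gamma_digraph from_U_def to_U_def steps_def ..
  have "card from_U = card (SIGMA i:{1..k}. {a \<in> tuples k d. a (2 * i - 1) = 1})"
    unfolding from_U_def by (rule card_image) (auto simp: inj_on_def)
  then have from_U: "card from_U = k * d ^ (2 * k - 1)"
    using assms(1) by (subst (asm) card_SIGMA_tuples_coordinate_1) auto
  have "card to_U = card (SIGMA i:{1..k}. {a \<in> tuples k d. a (2 * i) = 1})"
    unfolding to_U_def by (rule card_image) (auto simp: inj_on_def)
  then have to_U: "card to_U = k * d ^ (2 * k - 1)"
    using assms(1) by (subst (asm) card_SIGMA_tuples_coordinate_1) auto
  have "card steps = card (tuple_steps k d - Id)"
    unfolding steps_def by (rule card_image) (auto simp: inj_on_def)
  then have steps: "real (card steps)
      = ((real d ^ 2 + 3 * real d - 2) / 2) ^ (2 * k) - real d ^ (2 * k)"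
    using card_tuple_steps_minus_Id[OF assms(1)] by simp
  have "finite from_U" "finite to_U" "finite steps"
    using finite_parcs_Gamma_digraph[of k d] by (auto simp: parcs)
  moreover have "from_U \<inter> to_U = {}" "(from_U \<union> to_U) \<inter> steps = {}"
    by (auto simp: from_U_def to_U_def steps_def)
  ultimately have "card (parcs (Gamma_digraph k d)) = card from_U + card to_U + card steps"
    unfolding parcs by (simp add: card_Un_disjoint)
  moreover have "real d ^ (2 * k) = real d * real d ^ (2 * k - 1)"
    using assms(2) by (simp flip: power_Suc)
  ultimately show ?thesis using from_U to_U steps by (simp add: algebra_simps)
qed

lemma card_parcs_Gamma_bar_digraph:
  assumes "d \<ge> 1" "k \<ge> 1"
  shows "real (card (parcs (Gamma_bar_digraph k d)))
    = ((real d ^ 2 + 3 * real d - 2) / 2) ^ (2 * k) + (2 * real k - real d) * real d ^ (2 * k - 1)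
      + real k ^ 2 - real k"
proof -
  have "card (map_prod U U ` ({1..k} \<times> {1..k} - Id)) = card ({1..k} \<times> {1..k} - Id)"
    by (rule card_image) (auto simp: inj_on_def)
  moreover have "parcs (Gamma_digraph k d) \<inter> map_prod U U ` ({1..k} \<times> {1..k} - Id) = {}"
    by (auto simp: parcs_Gamma_digraph)
  ultimately have "card (parcs (Gamma_bar_digraph k d)) = card (parcs (Gamma_digraph k d)) + k * (k - 1)"
    unfolding parcs_Gamma_bar_digraph
    by (simp add: card_Un_disjoint finite_parcs_Gamma_digraph card_Times_minus_Id)
  moreover have "real (k * (k - 1)) = real k ^ 2 - real k"
    using assms(2) by (simp add: of_nat_diff power2_eq_square algebra_simps)
  ultimately show ?thesis using card_parcs_Gamma_digraph[OF assms] by simp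
qed

lemma card_parcs_Gamma_bar_digraph_1:
  assumes "k \<ge> 1"
  shows "card (parcs (Gamma_bar_digraph k 1)) = card (parcs (standard_complete (k + 1)))"
proof -
  have "real (card (parcs (Gamma_bar_digraph k 1))) = real (card (parcs (standard_complete (k + 1))))"
    using card_parcs_Gamma_bar_digraph[of 1 k] assms
    by (simp add: card_parcs_standard_complete power2_eq_square algebra_simps)
  then show ?thesis by (rule of_nat_eq_iff[THEN iffD1])
qed

lemma card_pverts_Gamma_bar_digraph: "card (pverts (Gamma_bar_digraph k d)) = k + d ^ (2 * k)"
proof -
  have "card (pverts (Gamma_bar_digraph k d)) = card (U ` {1..k}) + card (Tup ` tuples k d)"
    unfolding pverts_Gamma_bar_digraph by (rule card_Un_disjoint) (auto simp: finite_tuples)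
  then show ?thesis by (simp add: card_image inj_on_def card_tuples)
qed

text \<open>Every tuple other than \<open>(1, d, \<dots>, 1, d)\<close> has an arc to it.\<close>

lemma pverts_Gamma_bar_digraph_subset_Field:
  assumes "k \<ge> 1" "d \<ge> 1"
  shows "pverts (Gamma_bar_digraph k d) \<subseteq> Field (parcs (Gamma_bar_digraph k d))"
proof
  fix v assume "v \<in> pverts (Gamma_bar_digraph k d)"
  then consider i where "v = U i" "i \<in> {1..k}" | a where "v = Tup a" "a \<in> tuples k d"
    by (auto simp: pverts_Gamma_bar_digraph)
  then show "v \<in> Field (parcs (Gamma_bar_digraph k d))"
  proof cases
    case 1
    then have "(v, Tup (\<lambda>j\<in>{1..2 * k}. 1)) \<in> parcs (Gamma_bar_digraph k d)"
      using assms(2) by (auto simp: tuples_def)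
    then show ?thesis by (rule FieldI1)
  next
    case 2
    define b where "b = (\<lambda>j\<in>{1..2 * k}. if odd j then 1 else d)"
    have b: "b \<in> tuples k d" using assms(2) by (auto simp: b_def tuples_def)
    show ?thesis
    proof (cases "a = b")
      case True
      then have "(U 1, v) \<in> parcs (Gamma_bar_digraph k d)" using 2 assms(1) by (simp add: b_def)
      then show ?thesis by (rule FieldI2)
    next
      case False
      have "a (2 * r) \<le> Suc d" if "r \<in> {1..k}" for r
        using tuples_mem[OF 2(2), of "2 * r"] that by auto
      then have "(a, b) \<in> tuple_steps k d" using 2(2) b by (auto simp: tuple_steps_def b_def)
      then have "(v, Tup b) \<in> parcs (Gamma_bar_digraph k d)" using 2(1) False by simp
      then show ?thesis by (rule FieldI1)
    qed
  qed
qed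

lemma Gamma_bar_digraph_1: "Gamma_bar_digraph 1 d = Gamma_digraph 1 d"
  unfolding Gamma_bar_digraph_def by (rule pair_pre_digraph.equality) auto

subsection \<open>The upper bound\<close>

locale enumerated_resolving_set = strongly_connected_digraph G
  for G :: "('a, 'b) pre_digraph" (structure) +
  fixes w :: "nat \<Rightarrow> 'a" and k :: nat
  assumes inj_on_w: "inj_on w {1..k}"
    and weakly_resolving_w: "weakly_resolving (w ` {1..k})"
begin

definition dist_tuple :: "'a \<Rightarrow> nat \<Rightarrow> nat" where
  "dist_tuple x = (\<lambda>j\<in>{1..2 * k}.
    if odd j then ddist (w ((j + 1) div 2)) x else ddist x (w (j div 2)))"

definition code :: "'a \<Rightarrow> gamma_vertex" where
  "code x = (if x \<in> w ` {1..k} then U (the_inv_into {1..k} w x) else Tup (dist_tuple x))"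

lemma w_in_verts: "i \<in> {1..k} \<Longrightarrow> w i \<in> verts G"
  using weakly_resolving_w by (auto simp: weakly_resolving_def)

lemma dist_tuple_coordinates:
  assumes "i \<in> {1..k}"
  shows "dist_tuple x (2 * i - 1) = ddist (w i) x" "dist_tuple x (2 * i) = ddist x (w i)"
  using assms by (auto simp: dist_tuple_def)

lemma code_w: "i \<in> {1..k} \<Longrightarrow> code (w i) = U i"
  using inj_on_w by (simp add: code_def the_inv_into_f_f)

lemma code_cases:
  obtains (landmark) i where "i \<in> {1..k}" "x = w i" "code x = U i"
  | (other) "x \<notin> w ` {1..k}" "code x = Tup (dist_tuple x)"
proof (cases "x \<in> w ` {1..k}")
  case True
  then obtain i where "i \<in> {1..k}" "x = w i" by blast
  then show ?thesis using landmark code_w by simp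
next
  case False
  then show ?thesis using other by (simp add: code_def)
qed

lemma dist_tuple_in_tuples:
  assumes "x \<in> verts G" "x \<notin> w ` {1..k}"
  shows "dist_tuple x \<in> tuples k diam"
proof -
  have "\<forall>j\<in>{1..2 * k}. dist_tuple x j \<in> {1..diam}"
    unfolding ball_atLeastAtMost_double
  proof
    fix r assume r: "r \<in> {1..k}"
    then have "w r \<noteq> x" using assms(2) by blast
    then have "ddist (w r) x \<noteq> 0" "ddist x (w r) \<noteq> 0"
      using ddist_eq_0_iff reachable_verts w_in_verts[OF r] assms(1) by auto
    then show "dist_tuple x (2 * r - 1) \<in> {1..diam} \<and> dist_tuple x (2 * r) \<in> {1..diam}"
      using dist_tuple_coordinates[OF r] ddist_le_diam w_in_verts[OF r] assms(1) by simp
  qed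
  then show ?thesis by (auto simp: tuples_def dist_tuple_def)
qed

lemma dist_tuple_steps:
  assumes "x \<rightarrow> y" "x \<notin> w ` {1..k}" "y \<notin> w ` {1..k}"
  shows "(dist_tuple x, dist_tuple y) \<in> tuple_steps k diam"
  using assms adj_in_verts[OF assms(1)] w_in_verts ddist_from_adj_le ddist_to_adj_le reachable_verts
  by (simp add: tuple_steps_def dist_tuple_in_tuples dist_tuple_coordinates del: One_nat_def)

lemma inj_on_code: "inj_on code (verts G)"
proof (rule inj_onI, rule ccontr)
  fix x y assume xy: "x \<in> verts G" "y \<in> verts G" "code x = code y" "x \<noteq> y"
  then have eq: "dist_tuple x = dist_tuple y" by (cases x rule: code_cases; cases y rule: code_cases) auto
  obtain i where "i \<in> {1..k}" "two_way_dist (w i) x \<noteq> two_way_dist (w i) y"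
    using weakly_resolving_w xy unfolding weakly_resolving_def by blast
  then show False
    using eq dist_tuple_coordinates[of i x] dist_tuple_coordinates[of i y]
    by (simp add: two_way_dist_def)
qed

lemma arc_embedding_code: "arc_embedding code (Gamma_bar_digraph k diam)"
proof (rule arc_embeddingI)
  fix x assume "x \<in> verts G"
  then show "code x \<in> pverts (Gamma_bar_digraph k diam)"
    using dist_tuple_in_tuples[of x]
    by (cases x rule: code_cases) (auto simp: pverts_Gamma_bar_digraph)
next
  fix x y assume adj: "x \<rightarrow> y"
  note xy = adj_in_verts[OF adj] and dist = ddist_adj[OF adj]
  have "code x \<noteq> code y" using inj_on_code xy adj adj_not_same by (metis inj_onD)
  then show "(code x, code y) \<in> parcs (Gamma_bar_digraph k diam)"
    using xy dist dist_tuple_in_tuples[of x] dist_tuple_in_tuples[of y] dist_tuple_steps[OF adj]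
    by (cases x rule: code_cases; cases y rule: code_cases) (auto simp: dist_tuple_coordinates simp del: One_nat_def)
qed (rule inj_on_code)

lemma code_not_pair_isomorphism:
  assumes "k \<ge> 2" and d: "diam \<ge> 3"
  shows "\<not> pair_isomorphism code (Gamma_bar_digraph k diam)"
proof
  assume iso: "pair_isomorphism code (Gamma_bar_digraph k diam)"
  have k: "1 \<in> {1..k}" "2 \<in> {1..k}" using assms(1) by auto
  define a where "a = (\<lambda>j\<in>{1..2 * k}. if j = 3 then 3 else 1::nat)"
  have a: "a \<in> tuples k diam" "a 1 = 1" "a 3 = 3" using d k by (auto simp: a_def tuples_def)
  then have "Tup a \<in> code ` verts G"
    using iso by (simp add: pair_isomorphism_def bij_betw_def pverts_Gamma_bar_digraph)
  then obtain x where x: "x \<in> verts G" "code x = Tup a" by auto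
  then have "dist_tuple x = a" by (cases x rule: code_cases) auto
  then have "ddist (w 2) x = 3" using dist_tuple_coordinates(1)[OF k(2), of x] a(3) by simp
  moreover have "w 2 \<rightarrow> w 1" "w 1 \<rightarrow> x"
    using pair_isomorphism_adj_iff[OF iso] code_w k w_in_verts x a by simp_all
  then have "ddist (w 2) x \<le> 2"
    using ddist_from_adj_le[of "w 2" "w 1" x] ddist_adj by fastforce
  ultimately show False by simp
qed

end

context strongly_connected_digraph
begin

lemma enumerated_resolving_setE:
  obtains w where "enumerated_resolving_set G w weak_dim"
proof -
  obtain W where W: "weakly_resolving W" "card W = weak_dim" by (rule weak_dim_attained)
  then have "finite W" by (simp add: weakly_resolving_def)
  then obtain w where "bij_betw w {1..weak_dim} W"
    using W(2) by (metis ex_bij_betw_nat_finite_1)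
  then have "enumerated_resolving_set G w weak_dim"
    using W(1) by unfold_locales (auto simp: bij_betw_def)
  then show ?thesis by (rule that)
qed

lemma card_arcs_le_Gamma_bar:
  "card (arcs G) \<le> card (parcs (Gamma_bar_digraph weak_dim diam))"
proof -
  obtain w where "enumerated_resolving_set G w weak_dim" by (rule enumerated_resolving_setE)
  then show ?thesis
    using enumerated_resolving_set.arc_embedding_code finite_parcs_Gamma_bar_digraph
    by (intro arc_embedding_card_arcs_le)
qed

lemma Gamma_bar_isomorphismE:
  assumes "weak_dim \<ge> 1" "diam \<ge> 1"
    and "card (arcs G) = card (parcs (Gamma_bar_digraph weak_dim diam))"
  obtains f where "pair_isomorphism f (Gamma_bar_digraph weak_dim diam)" "weak_dim = 1 \<or> diam \<le> 2"
proof -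
  obtain w where "enumerated_resolving_set G w weak_dim" by (rule enumerated_resolving_setE)
  then interpret enumerated_resolving_set G w weak_dim .
  have iso: "pair_isomorphism code (Gamma_bar_digraph weak_dim diam)"
    using pverts_Gamma_bar_digraph_subset_Field[OF assms(1,2)] assms(3)
    by (intro arc_embedding_pair_isomorphism arc_embedding_code finite_parcs_Gamma_bar_digraph) auto
  moreover have "weak_dim = 1 \<or> diam \<le> 2"
    using iso code_not_pair_isomorphism assms(1) by fastforce
  ultimately show ?thesis by (rule that)
qed

lemma card_arcs_eq_Gamma_bar_iff_complete:
  assumes k: "weak_dim \<ge> 1" and d: "diam = 1"
  shows "card (arcs G) = card (parcs (Gamma_bar_digraph weak_dim 1)) \<longleftrightarrow>
    digraph_iso G (with_proj (standard_complete (weak_dim + 1)))"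
proof
  assume eq: "card (arcs G) = card (parcs (Gamma_bar_digraph weak_dim 1))"
  then obtain f where "pair_isomorphism f (Gamma_bar_digraph weak_dim 1)"
    using Gamma_bar_isomorphismE[OF k] unfolding d by blast
  then have "card (verts G) = card (pverts (Gamma_bar_digraph weak_dim 1))"
    unfolding pair_isomorphism_def by (blast dest: bij_betw_same_card)
  then have "card (verts G) = weak_dim + 1" by (simp add: card_pverts_Gamma_bar_digraph)
  then show "digraph_iso G (with_proj (standard_complete (weak_dim + 1)))"
    using digraph_iso_standard_complete eq card_parcs_Gamma_bar_digraph_1[OF k]
    by (simp add: card_parcs_standard_complete)
next
  assume "digraph_iso G (with_proj (standard_complete (weak_dim + 1)))"
  then show "card (arcs G) = card (parcs (Gamma_bar_digraph weak_dim 1))"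
    using digraph_iso_card_arcs card_parcs_Gamma_bar_digraph_1[OF k] by fastforce
qed

lemma card_arcs_eq_Gamma_bar_iff:
  assumes k: "weak_dim \<ge> 1" and d: "diam \<ge> 1"
  shows "card (arcs G) = card (parcs (Gamma_bar_digraph weak_dim diam)) \<longleftrightarrow>
    (weak_dim = 1 \<and> digraph_iso G (with_proj (Gamma_digraph 1 diam)))
    \<or> (diam = 1 \<and> digraph_iso G (with_proj (standard_complete (weak_dim + 1))))
    \<or> (diam = 2 \<and> digraph_iso G (with_proj (Gamma_bar_digraph weak_dim 2)))"
    (is "?extremal \<longleftrightarrow> ?classification")
proof
  assume eq: ?extremal
  obtain f where f: "pair_isomorphism f (Gamma_bar_digraph weak_dim diam)" "weak_dim = 1 \<or> diam \<le> 2"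
    using k d eq by (rule Gamma_bar_isomorphismE)
  then have iso: "digraph_iso G (with_proj (Gamma_bar_digraph weak_dim diam))"
    by (intro pair_isomorphism_digraph_iso)
  consider "weak_dim = 1" | "diam = 1" | "diam = 2" using f(2) d by linarith
  then show ?classification
  proof cases
    case 1
    then show ?thesis using iso unfolding 1 Gamma_bar_digraph_1 by simp
  next
    case 2
    then show ?thesis using eq card_arcs_eq_Gamma_bar_iff_complete[OF k] by simp
  next
    case 3
    then show ?thesis using iso by simp
  qed
next
  assume ?classification
  then consider "digraph_iso G (with_proj (Gamma_bar_digraph weak_dim diam))"
    | "diam = 1" "digraph_iso G (with_proj (standard_complete (weak_dim + 1)))"
    using Gamma_bar_digraph_1 by auto
  then show ?extremal
  proof cases
    case 1
    then show ?thesis using digraph_iso_card_arcs[OF 1] by simp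
  next
    case 2
    then show ?thesis using card_arcs_eq_Gamma_bar_iff_complete[OF k] by simp
  qed
qed

end

theorem theorem2p8:
  fixes G :: "('a, 'b) pre_digraph" and k d :: nat
  assumes "k \<ge> 1" and "d \<ge> 1"
    and "digraph G" and "strongly_connected G"
    and "pre_digraph.weak_dim G = k"
    and "pre_digraph.diam G = d"
  shows "k + d \<le> card (arcs G)
    \<and> real (card (arcs G)) \<le> ((real d ^ 2 + 3 * real d - 2) / 2) ^ (2 * k)
        + (2 * real k - real d) * real d ^ (2 * k - 1) + real k ^ 2 - real k
    \<and> (card (arcs G) = k + d \<longleftrightarrow>
        k = 1 \<and> digraph_iso G (with_proj (directed_cycle (d + 1))))
    \<and> (real (card (arcs G)) = ((real d ^ 2 + 3 * real d - 2) / 2) ^ (2 * k)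
        + (2 * real k - real d) * real d ^ (2 * k - 1) + real k ^ 2 - real k \<longleftrightarrow>
        (k = 1 \<and> digraph_iso G (with_proj (Gamma_digraph 1 d)))
      \<or> (d = 1 \<and> digraph_iso G (with_proj (standard_complete (k + 1))))
      \<or> (d = 2 \<and> digraph_iso G (with_proj (Gamma_bar_digraph k 2))))"
proof -
  interpret strongly_connected_digraph G
    using assms(3,4) by (simp add: strongly_connected_digraph_def strongly_connected_digraph_axioms_def)
  have k: "weak_dim = k" and d: "diam = d" using assms(5,6) by auto
  note bound = card_parcs_Gamma_bar_digraph[OF assms(2,1), symmetric]
  have "k + d \<le> card (arcs G)"
    using weak_dim_add_diam_le_card_arcs assms(2) by (simp add: k d)
  moreover have "card (arcs G) \<le> card (parcs (Gamma_bar_digraph k d))"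
    using card_arcs_le_Gamma_bar by (simp add: k d)
  moreover note card_arcs_eq_weak_dim_add_diam_iff[unfolded k d, OF assms(1,2)]
    and card_arcs_eq_Gamma_bar_iff[unfolded k d, OF assms(1,2)]
  ultimately show ?thesis unfolding bound of_nat_le_iff of_nat_eq_iff by (intro conjI)
qed

end
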